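(* The difference Burchnall-Chaundy equation $$Q_{n+1}(z+1)Q_{n-1}(z)-Q_{n+1}(z)Q_{n-1}(z+1)=Q_n(z)Q_n(z+1)$$ and the difference Dodgson equation $$R_{n+1}(z+1)R_{n-1}(z-1)-R_{n+1}(z-1)R_{n-1}(z+1)=R_n(z)^2$$ are equivalent on the set of initial data satisfying $\Phi_0=0$, where $$\Phi_n(z):=Q_{n}(z+1)Q_{n-1}(z-1)+Q_{n-1}(z+1)Q_{n}(z-1)-2Q_{n-1}(z)Q_n(z).$$ More precisely, if the initial data $Q_{-1}(z),Q_0(z)$ of the Cauchy problem for the difference Burchnall-Chaundy equation satisfy the constraint $$Q_{0}(z+1)Q_{-1}(z-1)+Q_{-1}(z+1)Q_{0}(z-1)-2Q_{-1}(z)Q_0(z)=0,$$ then $R_n(z)=2^{-\frac{n(n+1)}{2}}Q_n(z)$ satisfy the difference Dodgson equation.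
   Context: Both equations are recurrences in the integer index $n$ for sequences of functions of $z$, with initial data given by the functions with indices $-1$ and $0$; all equations are identities in $z$.
   Formalization: Functions are meromorphic on C, or arbitrary but nowhere zero (else the implication is false); the literal equivalence is claimed for rational functions only, since the converse fails in general, where the Dodgson side also requires Φ_n=0 for all n. *)

theory Defs
  imports "HOL-Complex_Analysis.Complex_Analysis"
begin

text \<open>
  A sequence of functions of \<open>z\<close> is a function \<open>Q :: int \<Rightarrow> 'a \<Rightarrow> 'b\<close>; every recurrence is imposed for
  \<open>n\<close> in an index set \<open>I\<close>. The filter \<open>F\<close> says what an identity in \<open>z\<close> means: for
  \<open>F = top\<close> it holds at every point, and for \<open>F = cosparse UNIV\<close> it holds off a closed
  discrete set of points, which is equality of meromorphic functions on the plane (the value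
  that HOL gives a meromorphic function at a pole is arbitrary).
\<close>

definition burchnall_chaundy_eq ::
    "'a filter \<Rightarrow> int set \<Rightarrow> (int \<Rightarrow> 'a :: ring_1 \<Rightarrow> 'b :: field) \<Rightarrow> bool" where
  "burchnall_chaundy_eq F I Q \<longleftrightarrow>
     (\<forall>n\<in>I. \<forall>\<^sub>F z in F.
        Q (n + 1) (z + 1) * Q (n - 1) z - Q (n + 1) z * Q (n - 1) (z + 1) = Q n z * Q n (z + 1))"

definition dodgson_eq ::
    "'a filter \<Rightarrow> int set \<Rightarrow> (int \<Rightarrow> 'a :: ring_1 \<Rightarrow> 'b :: field) \<Rightarrow> bool" where
  "dodgson_eq F I R \<longleftrightarrow>
     (\<forall>n\<in>I. \<forall>\<^sub>F z in F.
        R (n + 1) (z + 1) * R (n - 1) (z - 1) - R (n + 1) (z - 1) * R (n - 1) (z + 1) = (R n z)\<^sup>2)"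

definition Phi :: "(int \<Rightarrow> 'a :: ring_1 \<Rightarrow> 'b :: field) \<Rightarrow> int \<Rightarrow> 'a \<Rightarrow> 'b" where
  "Phi Q n z = Q n (z + 1) * Q (n - 1) (z - 1) + Q (n - 1) (z + 1) * Q n (z - 1)
                 - 2 * Q (n - 1) z * Q n z"

definition rescale :: "(int \<Rightarrow> 'a \<Rightarrow> 'b :: field) \<Rightarrow> int \<Rightarrow> 'a \<Rightarrow> 'b" where
  "rescale Q n z = 2 powi (- (n * (n + 1) div 2)) * Q n z"

definition rational_fun :: "(complex \<Rightarrow> complex) \<Rightarrow> bool" where
  "rational_fun f \<longleftrightarrow>
     (\<exists>p q. q \<noteq> 0 \<and> (\<forall>\<^sub>F z in cosparse UNIV. f z = poly p z / poly q z))"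

end

theory Submission
  imports Defs
begin

text \<open>
  Write \<open>a = Q (n - 1)\<close>, \<open>b = Q n\<close>, \<open>c = Q (n + 1)\<close>. The Burchnall-Chaundy equation at \<open>z\<close> and
  \<open>z - 1\<close> gives \<open>a (c\<^sub>+ a\<^sub>- - c\<^sub>- a\<^sub>+ - 2 b\<^sup>2) = b \<Phi>\<^sub>n\<close> and
  \<open>a \<Phi>\<^sub>n\<^sub>+\<^sub>1 = c \<Phi>\<^sub>n\<close>, so \<open>\<Phi> = 0\<close> propagates in \<open>n\<close> and makes the Dodgson equation hold.
  Conversely, \<open>\<Phi>\<^sub>n = 0\<close>, \<open>\<Phi>\<^sub>n\<^sub>+\<^sub>1 = 0\<close> and the Dodgson equation are linear in \<open>c\<^sub>+\<close>, \<open>c\<^sub>-\<close>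
  with determinant \<open>2 a b\<close>, and their solution is the Burchnall-Chaundy equation. If only one of
  \<open>\<Phi>\<^sub>n\<close>, \<open>\<Phi>\<^sub>n\<^sub>+\<^sub>1\<close> is known to vanish, the Burchnall-Chaundy defect \<open>X\<close> satisfies that
  \<open>X / (a a\<^sub>+)\<close> or \<open>X / (c c\<^sub>+)\<close> is antiperiodic with period 1, and an antiperiodic rational
  function is zero. These divisions are legitimate because either equation at \<open>n\<close> forces \<open>b = 0\<close>
  once \<open>a = 0\<close> or \<open>c = 0\<close>; and if \<open>b = 0\<close>, the equation at \<open>n + 1\<close> forces \<open>c = 0\<close>.
\<close>

section \<open>Powers of two in the rescaling\<close>

lemma rescale_exponent: "((n::int) + 1) * (n + 1 + 1) div 2 + (n - 1) * (n - 1 + 1) div 2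
    = 2 * (n * (n + 1) div 2) + 1"
proof -
  \<comment> \<open>Parity makes every \<open>div 2\<close> exact, which reduces the claim to a
    polynomial identity.\<close>
  have "even (n * (n + 1))" "even ((n + 1) * (n + 1 + 1))" "even ((n - 1) * (n - 1 + 1))"
    by auto
  then obtain u v w where *: "n * (n + 1) = 2 * u" "(n + 1) * (n + 1 + 1) = 2 * v"
    "(n - 1) * (n - 1 + 1) = 2 * w"
    by (meson evenE)
  have "2 * (v + w) = 2 * (2 * u + 1)"
    using * by (simp add: algebra_simps)
  then show ?thesis
    by (simp only: *) simp
qed

text \<open>Triangular numbers have second difference 1, so exactly one factor 2 is left over; it
  becomes the coefficient 2 in \<open>dodgson_iff\<close>.\<close>

lemma rescale_weight:
  "2 powi (- ((n + 1) * (n + 1 + 1) div 2)) * 2 powi (- ((n - 1) * (n - 1 + 1) div 2)) * 2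
    = (2 powi (- (n * (n + 1) div 2)) :: 'b :: field_char_0)\<^sup>2"
  (is "2 powi (- ?v) * 2 powi (- ?w) * 2 = (2 powi (- ?u))\<^sup>2")
proof -
  have e: "- ?v + - ?w + 1 = - ?u + - ?u"
    using rescale_exponent[of n] by linarith
  have "2 powi (- ?v) * 2 powi (- ?w) * 2 = (2 powi (- ?v + - ?w + 1) :: 'b)"
    by (subst power_int_add, simp)+ simp
  also have "\<dots> = (2 powi (- ?u))\<^sup>2"
    unfolding e power2_eq_square by (rule power_int_add) simp
  finally show ?thesis .
qed

text \<open>The step is an equivalence so that for \<open>I = UNIV\<close> it can also be used
  downwards, from 0 to the negative indices.\<close>

lemma index_set_induct [consumes 2, case_names step]:
  fixes I :: "int set"
  assumes "I = {0..} \<or> I = UNIV" "P 0" and step: "\<And>n. n \<in> I \<Longrightarrow> P n \<longleftrightarrow> P (n + 1)"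
    and "n \<in> I"
  shows "P n"
proof (cases "0 \<le> n")
  case True
  then show ?thesis
  proof (induction n rule: int_ge_induct)
    case (step m)
    moreover have "m \<in> I" using assms(1) step.hyps by auto
    ultimately show ?case using assms(3) by blast
  qed fact
next
  case False
  then have "I = UNIV" using assms(1,4) by auto
  have "n \<le> 0" using False by simp
  then show ?thesis
  proof (induction n rule: int_le_induct)
    case (step m)
    then show ?case using assms(3)[of "m - 1"] \<open>I = UNIV\<close> by simp
  qed fact
qed

section \<open>The two recurrences over a shift-invariant filter\<close>

text \<open>One filter covers both readings of an identity in \<open>z\<close>. The condition
  \<open>zero_or_nonzero\<close> stands in for the absence of zero divisors: it is what permits
  cancelling a factor \<open>Q n\<close>.\<close>

locale shift_sequence =
  fixes F :: "'a :: ring_1 filter" and Q :: "int \<Rightarrow> 'a \<Rightarrow> 'b :: field_char_0"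
  assumes nontrivial: "F \<noteq> bot"
    and shift_forward: "eventually P F \<Longrightarrow> eventually (\<lambda>z. P (z + 1)) F"
    and shift_backward: "eventually P F \<Longrightarrow> eventually (\<lambda>z. P (z - 1)) F"
    and zero_or_nonzero: "(\<forall>\<^sub>F z in F. Q n z = 0) \<or> (\<forall>\<^sub>F z in F. Q n z \<noteq> 0)"
begin

definition vanishes :: "int \<Rightarrow> bool" where
  "vanishes n \<longleftrightarrow> (\<forall>\<^sub>F z in F. Q n z = 0)"

abbreviation bc :: "int \<Rightarrow> bool" where
  "bc n \<equiv> burchnall_chaundy_eq F {n} Q"

abbreviation dodgson :: "int \<Rightarrow> bool" where
  "dodgson n \<equiv> dodgson_eq F {n} (rescale Q)"

abbreviation Phi_zero :: "int \<Rightarrow> bool" where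
  "Phi_zero n \<equiv> \<forall>\<^sub>F z in F. Phi Q n z = 0"

definition bc_defect :: "int \<Rightarrow> 'a \<Rightarrow> 'b" where
  "bc_defect n z = Q (n + 1) (z + 1) * Q (n - 1) z - Q (n + 1) z * Q (n - 1) (z + 1)
     - Q n z * Q n (z + 1)"

lemma nonvanishing:
  assumes "\<not> vanishes n"
  shows "\<forall>\<^sub>F z in F. Q n z \<noteq> 0 \<and> Q n (z + 1) \<noteq> 0 \<and> Q n (z - 1) \<noteq> 0"
proof -
  have "\<forall>\<^sub>F z in F. Q n z \<noteq> 0"
    using assms zero_or_nonzero unfolding vanishes_def by blast
  from this shift_forward[OF this] shift_backward[OF this] show ?thesis
    by eventually_elim simp
qed

lemma vanishing:
  assumes "vanishes n"
  shows "\<forall>\<^sub>F z in F. Q n z = 0 \<and> Q n (z + 1) = 0 \<and> Q n (z - 1) = 0"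
proof -
  have "\<forall>\<^sub>F z in F. Q n z = 0"
    using assms unfolding vanishes_def by blast
  from this shift_forward[OF this] shift_backward[OF this] show ?thesis
    by eventually_elim simp
qed

lemma bc_iff_defect: "bc n \<longleftrightarrow> (\<forall>\<^sub>F z in F. bc_defect n z = 0)"
  by (simp add: burchnall_chaundy_eq_def bc_defect_def)

lemma defect_backward: "bc_defect n (z - 1) = Q (n + 1) z * Q (n - 1) (z - 1)
    - Q (n + 1) (z - 1) * Q (n - 1) z - Q n (z - 1) * Q n z"
  by (simp add: bc_defect_def)

lemma bcD:
  assumes "bc n"
  shows "\<forall>\<^sub>F z in F. bc_defect n z = 0 \<and> bc_defect n (z - 1) = 0"
proof -
  from assms have "\<forall>\<^sub>F z in F. bc_defect n z = 0"
    by (simp only: bc_iff_defect)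
  from this shift_backward[OF this] show ?thesis
    by eventually_elim simp
qed

lemma dodgson_iff: "dodgson n \<longleftrightarrow> (\<forall>\<^sub>F z in F. Q (n + 1) (z + 1) * Q (n - 1) (z - 1)
    - Q (n + 1) (z - 1) * Q (n - 1) (z + 1) = 2 * (Q n z)\<^sup>2)"
proof -
  define k :: "int \<Rightarrow> 'b" where "k m = 2 powi (- (m * (m + 1) div 2))" for m
  have k: "k (n + 1) * k (n - 1) * 2 = (k n)\<^sup>2"
    unfolding k_def by (rule rescale_weight)
  have knz: "k (n + 1) * k (n - 1) \<noteq> 0"
    by (simp add: k_def)
  have "k (n + 1) * p * (k (n - 1) * q) - k (n + 1) * r * (k (n - 1) * s) = (k n * x)\<^sup>2
      \<longleftrightarrow> p * q - r * s = 2 * x\<^sup>2" for p q r s x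
  proof -
    have "k (n + 1) * p * (k (n - 1) * q) - k (n + 1) * r * (k (n - 1) * s)
        = k (n + 1) * k (n - 1) * (p * q - r * s)"
      by (simp add: algebra_simps)
    moreover have "(k n * x)\<^sup>2 = k (n + 1) * k (n - 1) * (2 * x\<^sup>2)"
      using k by (simp add: power_mult_distrib flip: mult.assoc)
    ultimately show ?thesis
      using knz by simp
  qed
  then show ?thesis
    unfolding dodgson_eq_def rescale_def k_def by simp
qed

text \<open>The two alternatives are, up to a constant, the right-hand sides of the Dodgson and the
  Burchnall-Chaundy equation, so one argument serves both.\<close>

lemma vanishes_if_square:
  assumes "\<forall>\<^sub>F z in F. Q n z * Q n z = 0 \<or> Q n z * Q n (z + 1) = 0"
  shows "vanishes n"
proof (rule ccontr)
  assume "\<not> vanishes n"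
  from assms nonvanishing[OF this] have "\<forall>\<^sub>F z in F. False"
    by eventually_elim auto
  with nontrivial show False
    by (simp add: trivial_limit_def)
qed

text \<open>Each product on the left of either equation has one factor from \<open>Q (n - 1)\<close>
  and one from \<open>Q (n + 1)\<close>, so a vanishing neighbour kills the whole left-hand
  side.\<close>

lemma vanishes_neighbour:
  assumes "bc n \<or> dodgson n" and "vanishes (n - 1) \<or> vanishes (n + 1)"
  shows "vanishes n"
proof (rule vanishes_if_square)
  have *: "\<forall>\<^sub>F z in F. (Q (n - 1) z = 0 \<and> Q (n - 1) (z + 1) = 0 \<and> Q (n - 1) (z - 1) = 0)
      \<or> (Q (n + 1) z = 0 \<and> Q (n + 1) (z + 1) = 0 \<and> Q (n + 1) (z - 1) = 0)"
    using assms(2)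
  proof
    assume "vanishes (n - 1)"
    from vanishing[OF this] show ?thesis by eventually_elim simp
  next
    assume "vanishes (n + 1)"
    from vanishing[OF this] show ?thesis by eventually_elim simp
  qed
  from assms(1) show "\<forall>\<^sub>F z in F. Q n z * Q n z = 0 \<or> Q n z * Q n (z + 1) = 0"
  proof
    assume "bc n"
    from bcD[OF this] * show ?thesis
      by eventually_elim (auto simp: bc_defect_def)
  next
    assume "dodgson n"
    from this[unfolded dodgson_iff] * show ?thesis
      by eventually_elim auto
  qed
qed

lemma Phi_zero_if_vanishes:
  assumes "vanishes n"
  shows "Phi_zero n" "Phi_zero (n + 1)"
  using vanishing[OF assms] by (auto elim!: eventually_mono simp: Phi_def)

text \<open>The equation at \<open>n + 1\<close> carries the zero from \<open>Q n\<close> to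
  \<open>Q (n + 1)\<close>, after which both sides at \<open>n\<close> are 0. This settles the
  degenerate case in which nothing can be cancelled.\<close>

lemma bc_dodgson_if_vanishes:
  assumes "vanishes n" and "bc (n + 1) \<or> dodgson (n + 1)"
  shows "bc n" "dodgson n"
proof -
  have "vanishes (n + 1)"
    using vanishes_neighbour[of "n + 1"] assms by simp
  from vanishing[OF assms(1)] vanishing[OF this]
  have *: "\<forall>\<^sub>F z in F. Q n z = 0 \<and> Q (n + 1) z = 0 \<and> Q (n + 1) (z + 1) = 0 \<and> Q (n + 1) (z - 1) = 0"
    by eventually_elim simp
  show "bc n"
    unfolding bc_iff_defect using * by eventually_elim (simp add: bc_defect_def)
  show "dodgson n"
    unfolding dodgson_iff using * by eventually_elim simp
qed

lemma Phi_zero_Suc_iff: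
  assumes "bc n"
  shows "Phi_zero n \<longleftrightarrow> Phi_zero (n + 1)"
proof (cases "vanishes n")
  case True
  then show ?thesis by (simp add: Phi_zero_if_vanishes)
next
  case False
  then have nz: "\<not> vanishes (n - 1)" "\<not> vanishes (n + 1)"
    using vanishes_neighbour assms by blast+
  have "\<forall>\<^sub>F z in F. Phi Q n z = 0 \<longleftrightarrow> Phi Q (n + 1) z = 0"
    using nonvanishing[OF nz(1)] nonvanishing[OF nz(2)] bcD[OF assms]
  proof eventually_elim
    case (elim z)
    \<comment> \<open>The products \<open>a c\<^sub>+\<close> and \<open>a c\<^sub>-\<close> are
      replaced using the equation at \<open>z\<close> and at \<open>z - 1\<close>; the two terms
      \<open>b b\<^sub>+ b\<^sub>-\<close> cancel.\<close>
    have "Q (n - 1) z * Phi Q (n + 1) z = Q (n + 1) z * Phi Q n z"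
      using elim(3) unfolding defect_backward unfolding bc_defect_def Phi_def add_diff_cancel_right' by algebra
    with elim show ?case by (metis mult_eq_0_iff)
  qed
  then show ?thesis
    by (rule eventually_subst)
qed

lemma dodgson_if_bc:
  assumes "bc n" "bc (n + 1)" "Phi_zero n"
  shows "dodgson n"
proof (cases "vanishes n")
  case True
  then show ?thesis using bc_dodgson_if_vanishes assms by blast
next
  case False
  then have nz: "\<not> vanishes (n - 1)"
    using vanishes_neighbour assms by blast
  show ?thesis
    unfolding dodgson_iff using nonvanishing[OF nz] bcD[OF assms(1)] assms(3)
  proof eventually_elim
    case (elim z)
    \<comment> \<open>After the same replacement the terms \<open>c a\<^sub>+ a\<^sub>-\<close>
      cancel and \<open>b (a\<^sub>- b\<^sub>+ + a\<^sub>+ b\<^sub>-)\<close> remains, which is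
      \<open>2 a b\<^sup>2\<close> by \<open>\<Phi>\<^sub>n = 0\<close>.\<close>
    have "Q (n - 1) z * (Q (n + 1) (z + 1) * Q (n - 1) (z - 1)
        - Q (n + 1) (z - 1) * Q (n - 1) (z + 1)) = Q (n - 1) z * (2 * (Q n z)\<^sup>2)"
      using elim(2,3) unfolding defect_backward unfolding bc_defect_def Phi_def by algebra
    with elim(1) show ?case by simp
  qed
qed

lemma bc_if_dodgson:
  assumes "dodgson n" "dodgson (n + 1)" "Phi_zero n" "Phi_zero (n + 1)"
  shows "bc n"
proof (cases "vanishes n")
  case True
  then show ?thesis using bc_dodgson_if_vanishes assms by blast
next
  case False
  show ?thesis
    unfolding bc_iff_defect
    using nonvanishing[OF False] assms(1)[unfolded dodgson_iff] assms(3,4)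
  proof eventually_elim
    case (elim z)
    \<comment> \<open>Adding \<open>b\<^sub>+\<close> times the Dodgson equation and
      \<open>a\<^sub>+\<close> times \<open>\<Phi>\<^sub>n\<^sub>+\<^sub>1 = 0\<close> eliminates
      \<open>c\<^sub>-\<close>; the coefficient of \<open>c\<^sub>+\<close> is then
      \<open>2 a b\<close> by \<open>\<Phi>\<^sub>n = 0\<close>.\<close>
    have "2 * Q n z * bc_defect n z = 0"
      using elim(2-4) unfolding bc_defect_def Phi_def add_diff_cancel_right' by algebra
    with elim(1) show ?case by simp
  qed
qed

lemma bc_iff_dodgson_Phi:
  assumes "I = {0..} \<or> I = UNIV" "Phi_zero 0"
  shows "burchnall_chaundy_eq F I Q \<longleftrightarrow>
    dodgson_eq F I (rescale Q) \<and> (\<forall>n\<in>I. Phi_zero n)"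
proof -
  \<comment> \<open>Both implications at \<open>n\<close> also call on data at \<open>n + 1\<close>,
    so closure of \<open>I\<close> under successor matters.\<close>
  have up: "n + 1 \<in> I" if "n \<in> I" for n
    using that assms(1) by auto
  have split: "burchnall_chaundy_eq F I Q \<longleftrightarrow> (\<forall>n\<in>I. bc n)"
    "dodgson_eq F I (rescale Q) \<longleftrightarrow> (\<forall>n\<in>I. dodgson n)"
    by (auto simp: burchnall_chaundy_eq_def dodgson_eq_def)
  have "Phi_zero n" if "\<forall>n\<in>I. bc n" "n \<in> I" for n
    using assms _ that(2) by (rule index_set_induct) (use that(1) in \<open>auto intro!: Phi_zero_Suc_iff\<close>)
  then show ?thesis
    unfolding split using up dodgson_if_bc bc_if_dodgson by blast
qed

end

section \<open>The converse from the constraint at index 0 alone\<close>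

locale rigid_shift_sequence = shift_sequence +
  assumes defect_rigid: "\<And>n k. \<not> vanishes k \<Longrightarrow>
    (\<forall>\<^sub>F z in F. bc_defect n z * Q k (z - 1) + bc_defect n (z - 1) * Q k (z + 1) = 0) \<Longrightarrow>
    (\<forall>\<^sub>F z in F. bc_defect n z = 0)"
begin

text \<open>The first disjunct is what an upward induction knows, the second what a downward one
  knows; rigidity makes up for the missing constraint.\<close>

lemma bc_if_dodgson_one_sided:
  assumes "dodgson n" "dodgson (n + 1)" "Phi_zero n \<or> Phi_zero (n + 1)"
  shows "bc n"
proof (cases "vanishes n")
  case True
  then show ?thesis using bc_dodgson_if_vanishes assms by blast
next
  case False
  then have nz: "\<not> vanishes (n - 1)" "\<not> vanishes (n + 1)"
    using vanishes_neighbour assms by blast+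
  from assms(3) show ?thesis
  proof
    \<comment> \<open>The sum below equals \<open>a (c\<^sub>+ a\<^sub>- - c\<^sub>- a\<^sub>+) - b
      (a\<^sub>- b\<^sub>+ + a\<^sub>+ b\<^sub>-)\<close>, and both terms have the value
      \<open>2 a b\<^sup>2\<close>.\<close>
    assume "Phi_zero n"
    from assms(1)[unfolded dodgson_iff] this
    have "\<forall>\<^sub>F z in F. bc_defect n z * Q (n - 1) (z - 1) + bc_defect n (z - 1) * Q (n - 1) (z + 1) = 0"
    proof eventually_elim
      case (elim z)
      then show ?case unfolding defect_backward unfolding bc_defect_def Phi_def by algebra
    qed
    with nz(1) show ?thesis
      unfolding bc_iff_defect by (rule defect_rigid)
  next
    \<comment> \<open>The mirror image with \<open>c\<close> in place of \<open>a\<close>: both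
      terms have the value \<open>2 b\<^sup>2 c\<close>.\<close>
    assume "Phi_zero (n + 1)"
    from assms(1)[unfolded dodgson_iff] this
    have "\<forall>\<^sub>F z in F. bc_defect n z * Q (n + 1) (z - 1) + bc_defect n (z - 1) * Q (n + 1) (z + 1) = 0"
    proof eventually_elim
      case (elim z)
      then show ?case
        unfolding defect_backward unfolding bc_defect_def Phi_def add_diff_cancel_right' by algebra
    qed
    with nz(2) show ?thesis
      unfolding bc_iff_defect by (rule defect_rigid)
  qed
qed

lemma bc_iff_dodgson:
  assumes "I = {0..} \<or> I = UNIV" "Phi_zero 0"
  shows "burchnall_chaundy_eq F I Q \<longleftrightarrow> dodgson_eq F I (rescale Q)"
proof
  assume "burchnall_chaundy_eq F I Q"
  then show "dodgson_eq F I (rescale Q)"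
    using bc_iff_dodgson_Phi[OF assms] by blast
next
  assume "dodgson_eq F I (rescale Q)"
  then have D: "\<forall>n\<in>I. dodgson n"
    by (auto simp: dodgson_eq_def)
  \<comment> \<open>Either constraint yields the Burchnall-Chaundy equation at \<open>n\<close>,
    which in turn yields the other constraint.\<close>
  have *: "Phi_zero n \<longleftrightarrow> Phi_zero (n + 1)" if "n \<in> I" for n
  proof -
    have "n + 1 \<in> I"
      using that assms(1) by auto
    then have "bc n" if "Phi_zero n \<or> Phi_zero (n + 1)"
      using bc_if_dodgson_one_sided that D \<open>n \<in> I\<close> by blast
    then show ?thesis
      using Phi_zero_Suc_iff by blast
  qed
  have "Phi_zero n" if "n \<in> I" for n
    using assms * that by (rule index_set_induct)
  with \<open>dodgson_eq F I (rescale Q)\<close> show "burchnall_chaundy_eq F I Q"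
    using bc_iff_dodgson_Phi[OF assms] by blast
qed

end

section \<open>Rational functions and antiperiodicity\<close>

lemma eventually_cosparse_shift:
  fixes d :: complex
  assumes "eventually P (cosparse UNIV)"
  shows "eventually (\<lambda>z. P (z + d)) (cosparse UNIV)"
proof -
  have "eventually (\<lambda>z. P (z + d)) (at a)" for a
  proof -
    have "at (a + d) = filtermap (\<lambda>z. z + d) (at a)"
      using filtermap_at_shift[of "- d" a] by simp
    moreover have "eventually P (at (a + d))"
      using assms by (simp add: eventually_cosparse_open_eq)
    ultimately show ?thesis
      by (simp add: eventually_filtermap)
  qed
  then show ?thesis
    by (simp add: eventually_cosparse_open_eq)
qed

lemma poly_nonzero_cosparse:
  fixes q :: "complex poly"
  assumes "q \<noteq> 0"
  shows "\<forall>\<^sub>F z in cosparse UNIV. poly q z \<noteq> 0"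
  using poly_roots_finite[OF assms]
  by (auto simp: eventually_cosparse sparse_in_open islimpt_finite)

lemma poly_eq_0_if_cosparse:
  fixes q :: "complex poly"
  assumes "\<forall>\<^sub>F z in cosparse UNIV. poly q z = 0"
  shows "q = 0"
proof (rule ccontr)
  assume "q \<noteq> 0"
  from poly_nonzero_cosparse[OF this] assms have "eventually (\<lambda>_. False) (cosparse (UNIV :: complex set))"
    by eventually_elim simp
  then show False
    by (simp flip: trivial_limit_def)
qed

lemma rational_funE:
  assumes "rational_fun f"
  obtains p q where "q \<noteq> 0" "\<forall>\<^sub>F z in cosparse UNIV. f z = poly p z / poly q z \<and> poly q z \<noteq> 0"
proof -
  from assms obtain p q where pq: "q \<noteq> 0" "\<forall>\<^sub>F z in cosparse UNIV. f z = poly p z / poly q z"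
    unfolding rational_fun_def by blast
  from pq(2) poly_nonzero_cosparse[OF pq(1)]
  have "\<forall>\<^sub>F z in cosparse UNIV. f z = poly p z / poly q z \<and> poly q z \<noteq> 0"
    by eventually_elim simp
  with pq(1) show thesis by (rule that)
qed

lemma rational_fun_shift:
  assumes "rational_fun f"
  shows "rational_fun (\<lambda>z. f (z + d))"
proof -
  from assms obtain p q where pq: "q \<noteq> 0" "\<forall>\<^sub>F z in cosparse UNIV. f z = poly p z / poly q z"
    unfolding rational_fun_def by blast
  have "\<forall>\<^sub>F z in cosparse UNIV. f (z + d) = poly (p \<circ>\<^sub>p [:d, 1:]) z / poly (q \<circ>\<^sub>p [:d, 1:]) z"
    using eventually_cosparse_shift[OF pq(2), of d] by (simp add: poly_pcompose add.commute)
  moreover have "q \<circ>\<^sub>p [:d, 1:] \<noteq> 0"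
    using pq(1) by (simp add: pcompose_eq_0_iff)
  ultimately show ?thesis
    unfolding rational_fun_def by blast
qed

lemma rational_fun_mult:
  assumes "rational_fun f" "rational_fun g"
  shows "rational_fun (\<lambda>z. f z * g z)"
proof -
  from assms(1) obtain p q where pq: "q \<noteq> 0"
    "\<forall>\<^sub>F z in cosparse UNIV. f z = poly p z / poly q z \<and> poly q z \<noteq> 0"
    by (rule rational_funE)
  from assms(2) obtain r s where rs: "s \<noteq> 0"
    "\<forall>\<^sub>F z in cosparse UNIV. g z = poly r z / poly s z \<and> poly s z \<noteq> 0"
    by (rule rational_funE)
  from pq(2) rs(2) have "\<forall>\<^sub>F z in cosparse UNIV. f z * g z = poly (p * r) z / poly (q * s) z"
    by eventually_elim simp
  moreover have "q * s \<noteq> 0"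
    using pq rs by simp
  ultimately show ?thesis
    unfolding rational_fun_def by blast
qed

lemma rational_fun_diff:
  assumes "rational_fun f" "rational_fun g"
  shows "rational_fun (\<lambda>z. f z - g z)"
proof -
  from assms(1) obtain p q where pq: "q \<noteq> 0"
    "\<forall>\<^sub>F z in cosparse UNIV. f z = poly p z / poly q z \<and> poly q z \<noteq> 0"
    by (rule rational_funE)
  from assms(2) obtain r s where rs: "s \<noteq> 0"
    "\<forall>\<^sub>F z in cosparse UNIV. g z = poly r z / poly s z \<and> poly s z \<noteq> 0"
    by (rule rational_funE)
  from pq(2) rs(2)
  have "\<forall>\<^sub>F z in cosparse UNIV. f z - g z = poly (p * s - r * q) z / poly (q * s) z"
    by eventually_elim (simp add: diff_frac_eq)
  moreover have "q * s \<noteq> 0"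
    using pq rs by simp
  ultimately show ?thesis
    unfolding rational_fun_def by blast
qed

lemma rational_fun_inverse:
  assumes "rational_fun f"
  shows "rational_fun (\<lambda>z. inverse (f z))"
proof -
  from assms obtain p q where pq: "q \<noteq> 0" "\<forall>\<^sub>F z in cosparse UNIV. f z = poly p z / poly q z"
    unfolding rational_fun_def by blast
  show ?thesis
  proof (cases "p = 0")
    case True
    \<comment> \<open>By the convention \<open>inverse 0 = 0\<close> the zero function is its own
      inverse.\<close>
    have "\<forall>\<^sub>F z in cosparse UNIV. inverse (f z) = poly 0 z / poly 1 z"
      using pq(2) by eventually_elim (simp add: True)
    then show ?thesis
      unfolding rational_fun_def using one_neq_zero by blast
  next
    case False
    have "\<forall>\<^sub>F z in cosparse UNIV. inverse (f z) = poly q z / poly p z"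
      using pq(2) by eventually_elim simp
    with False show ?thesis
      unfolding rational_fun_def by blast
  qed
qed

text \<open>Clearing denominators gives \<open>p' * q + p * q' = 0\<close>. The shift preserves
  degrees and leading coefficients, so the top coefficients of the two products are equal and add up
  instead of cancelling; hence \<open>p = 0\<close>.\<close>

lemma antiperiodic_rational_fun_eq_0:
  assumes "rational_fun f" and "\<forall>\<^sub>F z in cosparse UNIV. f (z + 1) = - f z"
  shows "\<forall>\<^sub>F z in cosparse UNIV. f z = 0"
proof -
  from assms(1) obtain p q where pq: "q \<noteq> 0"
    "\<forall>\<^sub>F z in cosparse UNIV. f z = poly p z / poly q z \<and> poly q z \<noteq> 0"
    by (rule rational_funE)
  define p' q' where "p' = p \<circ>\<^sub>p [:1, 1:]" and "q' = q \<circ>\<^sub>p [:1, 1:]"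
  have "\<forall>\<^sub>F z in cosparse UNIV. poly (p' * q + p * q') z = 0"
    using assms(2) pq(2) eventually_cosparse_shift[OF pq(2), of 1]
  proof eventually_elim
    case (elim z)
    then have "poly p (z + 1) / poly q (z + 1) = - poly p z / poly q z"
      by simp
    with elim have "poly p (z + 1) * poly q z = - poly p z * poly q (z + 1)"
      by (simp add: field_simps)
    then show ?case
      by (simp add: p'_def q'_def poly_pcompose add.commute)
  qed
  then have "p' * q + p * q' = 0"
    by (rule poly_eq_0_if_cosparse)
  moreover have "degree p' = degree p" "degree q' = degree q"
    by (simp_all add: p'_def q'_def degree_pcompose)
  moreover have "lead_coeff p' = lead_coeff p" "lead_coeff q' = lead_coeff q"
    by (simp_all add: p'_def q'_def lead_coeff_comp)
  ultimately have "2 * (lead_coeff p * lead_coeff q) = 0"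
    using coeff_mult_degree_sum[of p' q] coeff_mult_degree_sum[of p q']
    by (metis coeff_0 coeff_add mult_2)
  then have "p = 0"
    using pq(1) by simp
  show ?thesis
    using pq(2) by eventually_elim (simp add: \<open>p = 0\<close>)
qed

lemma antiperiodic_quotient_eq_0:
  assumes "rational_fun X" "rational_fun a" and nz: "\<forall>\<^sub>F z in cosparse UNIV. a z \<noteq> 0"
    and eq: "\<forall>\<^sub>F z in cosparse UNIV. X z * a (z - 1) + X (z - 1) * a (z + 1) = 0"
  shows "\<forall>\<^sub>F z in cosparse UNIV. X z = 0"
proof -
  define f where "f z = X z * inverse (a z * a (z + 1))" for z
  have "rational_fun f"
    unfolding f_def using assms(1,2)
    by (intro rational_fun_mult rational_fun_inverse rational_fun_shift)
  moreover have "\<forall>\<^sub>F z in cosparse UNIV. f (z + 1) = - f z"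
    \<comment> \<open>The relation \<open>eq\<close> is taken at \<open>z + 1\<close>, where it
      links \<open>X (z + 1)\<close> to \<open>X z\<close>; this brings in
      \<open>a (z + 2)\<close>.\<close>
    using nz eventually_cosparse_shift[OF nz, of 1] eventually_cosparse_shift[OF nz, of 2]
      eventually_cosparse_shift[OF eq, of 1]
  proof eventually_elim
    case (elim z)
    have "X (z + 1) * a z + X z * a (z + 2) = 0"
      using elim(4) by (simp add: add.assoc)
    then have "X (z + 1) * a z = - X z * a (z + 2)"
      by (simp add: eq_neg_iff_add_eq_0)
    with elim(1-3) show ?case
      by (simp add: f_def field_simps)
  qed
  ultimately have "\<forall>\<^sub>F z in cosparse UNIV. f z = 0"
    by (rule antiperiodic_rational_fun_eq_0)
  from this nz eventually_cosparse_shift[OF nz, of 1] show ?thesis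
    by eventually_elim (simp add: f_def)
qed

section \<open>Instances of the locales and the theorem\<close>

text \<open>The dichotomy is the identity theorem for meromorphic functions on the connected
  plane.\<close>

lemma shift_sequence_meromorphic:
  fixes Q :: "int \<Rightarrow> complex \<Rightarrow> complex"
  assumes "\<forall>n. Q n meromorphic_on UNIV"
  shows "shift_sequence (cosparse UNIV) Q"
proof
  show "cosparse (UNIV :: complex set) \<noteq> bot"
    by simp
  show "eventually (\<lambda>z. P (z + 1)) (cosparse UNIV)" "eventually (\<lambda>z. P (z - 1)) (cosparse UNIV)"
    if "eventually P (cosparse UNIV)" for P :: "complex \<Rightarrow> bool"
    using eventually_cosparse_shift[OF that, of 1] eventually_cosparse_shift[OF that, of "- 1"]
    by simp_all
  show "(\<forall>\<^sub>F z in cosparse UNIV. Q n z = 0) \<or> (\<forall>\<^sub>F z in cosparse UNIV. Q n z \<noteq> 0)" for n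
    by (rule meromorphic_imp_constant_or_avoid) (use assms in auto)
qed

lemma rigid_shift_sequence_rational:
  fixes Q :: "int \<Rightarrow> complex \<Rightarrow> complex"
  assumes "\<forall>n. Q n meromorphic_on UNIV" and rat: "\<forall>n. rational_fun (Q n)"
  shows "rigid_shift_sequence (cosparse UNIV) Q"
proof -
  interpret shift_sequence "cosparse UNIV" Q
    using assms(1) by (rule shift_sequence_meromorphic)
  show ?thesis
  proof
    fix n k
    assume "\<not> vanishes k"
    then have nz: "\<forall>\<^sub>F z in cosparse UNIV. Q k z \<noteq> 0"
      using zero_or_nonzero unfolding vanishes_def by blast
    have "rational_fun (bc_defect n)"
      unfolding bc_defect_def using rat
      by (intro rational_fun_diff rational_fun_mult rational_fun_shift) auto
    then show "\<forall>\<^sub>F z in cosparse UNIV. bc_defect n z = 0"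
      if "\<forall>\<^sub>F z in cosparse UNIV. bc_defect n z * Q k (z - 1) + bc_defect n (z - 1) * Q k (z + 1) = 0"
      using rat nz that by (blast intro: antiperiodic_quotient_eq_0)
  qed
qed

lemma shift_sequence_top:
  fixes S :: "int \<Rightarrow> 'a :: ring_1 \<Rightarrow> 'b :: field_char_0"
  assumes "\<forall>n z. S n z \<noteq> 0"
  shows "shift_sequence top S"
  by unfold_locales (use assms in \<open>simp_all add: eventually_top trivial_limit_def\<close>)

theorem theorem1:
  fixes I :: "int set"
    and Q :: "int \<Rightarrow> complex \<Rightarrow> complex"
    and S :: "int \<Rightarrow> 'a :: ring_1 \<Rightarrow> 'b :: field_char_0"
  assumes "I = {0..} \<or> I = UNIV"
  shows
    "((\<forall>n. Q n meromorphic_on UNIV) \<and> (\<forall>\<^sub>F z in cosparse UNIV. Phi Q 0 z = 0) \<longrightarrow>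
        (burchnall_chaundy_eq (cosparse UNIV) I Q \<longrightarrow>
           dodgson_eq (cosparse UNIV) I (rescale Q)) \<and>
        ((\<forall>n. rational_fun (Q n)) \<longrightarrow>
           (burchnall_chaundy_eq (cosparse UNIV) I Q \<longleftrightarrow>
              dodgson_eq (cosparse UNIV) I (rescale Q))) \<and>
        (burchnall_chaundy_eq (cosparse UNIV) I Q \<longleftrightarrow>
           dodgson_eq (cosparse UNIV) I (rescale Q) \<and>
           (\<forall>n\<in>I. \<forall>\<^sub>F z in cosparse UNIV. Phi Q n z = 0))) \<and>
     ((\<forall>n z. S n z \<noteq> 0) \<and> (\<forall>z. Phi S 0 z = 0) \<longrightarrow>
        (burchnall_chaundy_eq top I S \<longrightarrow> dodgson_eq top I (rescale S)) \<and>
        (burchnall_chaundy_eq top I S \<longleftrightarrow>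
           dodgson_eq top I (rescale S) \<and> (\<forall>n\<in>I. \<forall>z. Phi S n z = 0)))"
proof (intro conjI impI)
  assume "(\<forall>n. Q n meromorphic_on UNIV) \<and> (\<forall>\<^sub>F z in cosparse UNIV. Phi Q 0 z = 0)"
  then have mero: "\<forall>n. Q n meromorphic_on UNIV" and Phi: "\<forall>\<^sub>F z in cosparse UNIV. Phi Q 0 z = 0"
    by blast+
  interpret shift_sequence "cosparse UNIV" Q
    using mero by (rule shift_sequence_meromorphic)
  show iff: "burchnall_chaundy_eq (cosparse UNIV) I Q \<longleftrightarrow>
      dodgson_eq (cosparse UNIV) I (rescale Q) \<and> (\<forall>n\<in>I. \<forall>\<^sub>F z in cosparse UNIV. Phi Q n z = 0)"
    using assms Phi by (rule bc_iff_dodgson_Phi)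
  then show "dodgson_eq (cosparse UNIV) I (rescale Q)" if "burchnall_chaundy_eq (cosparse UNIV) I Q"
    using that by blast
  show "burchnall_chaundy_eq (cosparse UNIV) I Q \<longleftrightarrow> dodgson_eq (cosparse UNIV) I (rescale Q)"
    if "\<forall>n. rational_fun (Q n)"
    using rigid_shift_sequence.bc_iff_dodgson[OF rigid_shift_sequence_rational[OF mero that] assms Phi] .
next
  assume S: "(\<forall>n z. S n z \<noteq> 0) \<and> (\<forall>z. Phi S 0 z = 0)"
  then interpret shift_sequence top S
    by (intro shift_sequence_top) blast
  show iff: "burchnall_chaundy_eq top I S \<longleftrightarrow>
      dodgson_eq top I (rescale S) \<and> (\<forall>n\<in>I. \<forall>z. Phi S n z = 0)"
    using bc_iff_dodgson_Phi[OF assms] S by (simp add: eventually_top)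
  then show "dodgson_eq top I (rescale S)" if "burchnall_chaundy_eq top I S"
    using that by blast
qed

end
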